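(* Let $(\Phi^{(j)})_{j=1}^\infty$ be a non-autonomous IFS on a compact metric space $X$ with limit set $J$ and associated nerves $\mathcal N_{0,k}$ ($k\ge1$). The following are equivalent. (1) The limit set $J$ is connected. (2) For every $k>0$, the simplicial complex $\mathcal N_{0,k}$ is connected.
   Context: Let $X$ be a non-empty compact metric space; $\mathrm{Lip}(f)$ denotes the Lipschitz constant of $f\colon X\to X$. A non-autonomous IFS $(\Phi^{(j)})_{j\ge1}$ on $X$ is a sequence of collections $\Phi^{(j)}=\{f^{(j)}_i\colon X\to X\}_{i\in I^{(j)}}$ of maps, with each index set $I^{(j)}$ finite and non-empty, such that there is a constant $c<1$ with $\mathrm{Lip}(f^{(j)}_i)\le c$ for all $j\ge1$, $i\in I^{(j)}$. Its coding map $\Pi\colon\prod_{j\ge1}I^{(j)}\to X$ is defined by $\{\Pi(i_1,i_2,\dots)\}=\bigcap_{j\ge1}f^{(1)}_{i_1}\circ\cdots\circ f^{(j)}_{i_j}(X)$, and its limit set is $J=\Pi(\prod_{j\ge1}I^{(j)})$. For $j\ge0$, $J_j$ denotes the limit set of the shifted system $(\Phi^{(j+k)})_{k\ge1}$, so $J_0=J$. For $0\le j<k$ and $v=(i_{j+1},\dots,i_k)\in I^{(j+1)}\times\cdots\times I^{(k)}$ put $f_v=f^{(j+1)}_{i_{j+1}}\circ\cdots\circ f^{(k)}_{i_k}$. The nerve $\mathcal N_{j,k}$ is the abstract simplicial complex with vertex set $I^{(j+1)}\times\cdots\times I^{(k)}$, in which a set $\{v_0,\dots,v_q\}$ of mutually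 distinct vertices is a simplex iff $\bigcap_{p=0}^q f_{v_p}(J_k)\ne\emptyset$. A simplicial complex is connected if the equivalence relation on its vertex set generated by $u\sim v$ whenever $\{u,v\}$ is a 1-simplex has exactly one class. *)

theory Defs
  imports "HOL-Analysis.Analysis"
begin

text \<open>
  Time steps are the natural numbers \<open>j \<ge> 1\<close>; \<open>I 0\<close> and \<open>f 0\<close> are never used.
  \<open>f j i\<close> is the map with index \<open>i \<in> I j\<close> of the \<open>j\<close>-th collection; it is a total
  function on the ambient type, of which only the restriction to \<open>X\<close> matters.
\<close>

definition nonautonomous_ifs ::
  "'a::metric_space set \<Rightarrow> (nat \<Rightarrow> 'i set) \<Rightarrow> (nat \<Rightarrow> 'i \<Rightarrow> 'a \<Rightarrow> 'a) \<Rightarrow> bool" where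
  "nonautonomous_ifs X I f \<longleftrightarrow>
     (\<forall>j\<ge>1. finite (I j) \<and> I j \<noteq> {}) \<and>
     (\<forall>j\<ge>1. \<forall>i\<in>I j. f j i \<in> X \<rightarrow> X) \<and>
     (\<exists>c<1. \<forall>j\<ge>1. \<forall>i\<in>I j. c-lipschitz_on X (f j i))"

text \<open>
  The composition \<open>f (j+1) (v (j+1)) \<circ> \<dots> \<circ> f k (v k)\<close>, the identity if \<open>k \<le> j\<close>.
  Words and infinite sequences are both functions of the time step.
\<close>

definition word_map ::
  "(nat \<Rightarrow> 'i \<Rightarrow> 'a \<Rightarrow> 'a) \<Rightarrow> nat \<Rightarrow> nat \<Rightarrow> (nat \<Rightarrow> 'i) \<Rightarrow> 'a \<Rightarrow> 'a" where
  "word_map f j k v = foldr (\<lambda>m g. f m (v m) \<circ> g) [Suc j..<Suc k] id"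

definition words :: "(nat \<Rightarrow> 'i set) \<Rightarrow> nat \<Rightarrow> nat \<Rightarrow> (nat \<Rightarrow> 'i) set" where
  "words I j k = (\<Pi>\<^sub>E m\<in>{Suc j..k}. I m)"

definition coding_map ::
  "'a set \<Rightarrow> (nat \<Rightarrow> 'i \<Rightarrow> 'a \<Rightarrow> 'a) \<Rightarrow> (nat \<Rightarrow> 'i) \<Rightarrow> 'a" where
  "coding_map X f \<sigma> = (THE x. {x} = (\<Inter>j\<in>{1..}. word_map f 0 j \<sigma> ` X))"

definition limit_set ::
  "'a set \<Rightarrow> (nat \<Rightarrow> 'i set) \<Rightarrow> (nat \<Rightarrow> 'i \<Rightarrow> 'a \<Rightarrow> 'a) \<Rightarrow> 'a set" where
  "limit_set X I f = coding_map X f ` (\<Pi>\<^sub>E m\<in>{1..}. I m)"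

definition shifted_limit_set ::
  "'a set \<Rightarrow> (nat \<Rightarrow> 'i set) \<Rightarrow> (nat \<Rightarrow> 'i \<Rightarrow> 'a \<Rightarrow> 'a) \<Rightarrow> nat \<Rightarrow> 'a set" where
  "shifted_limit_set X I f j = limit_set X (\<lambda>k. I (j + k)) (\<lambda>k. f (j + k))"

record 'v abstract_complex =
  vertices :: "'v set"
  simplices :: "'v set set"

definition nerve ::
  "'a set \<Rightarrow> (nat \<Rightarrow> 'i set) \<Rightarrow> (nat \<Rightarrow> 'i \<Rightarrow> 'a \<Rightarrow> 'a) \<Rightarrow> nat \<Rightarrow> nat
     \<Rightarrow> (nat \<Rightarrow> 'i) abstract_complex" where
  "nerve X I f j k =
     \<lparr>vertices = words I j k,
      simplices = {S. S \<subseteq> words I j k \<and> finite S \<and> S \<noteq> {} \<and>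
        (\<Inter>v\<in>S. word_map f j k v ` shifted_limit_set X I f k) \<noteq> {}}\<rparr>"

definition edge_rel :: "'v abstract_complex \<Rightarrow> ('v \<times> 'v) set" where
  "edge_rel K = {(u, v). u \<noteq> v \<and> {u, v} \<in> simplices K}"

definition generated_equiv :: "'v set \<Rightarrow> ('v \<times> 'v) set \<Rightarrow> ('v \<times> 'v) set" where
  "generated_equiv V E = \<Inter>{R. equiv V R \<and> E \<subseteq> R}"

definition connected_complex :: "'v abstract_complex \<Rightarrow> bool" where
  "connected_complex K \<longleftrightarrow>
     (\<exists>!C. C \<in> vertices K // generated_equiv (vertices K) (edge_rel K))"

end

theory Submission imports Defs begin

text \<open>
  Both directions rest on the decomposition \<open>J = (\<Union>v. f\<^sub>v(J\<^sub>k))\<close> over the finitely many words \<open>v\<close>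
  of length \<open>k\<close> (\<open>limit_set_decomposition\<close>) and on the compactness of the limit sets
  (\<open>compact_limit_set\<close>), so that the pieces \<open>f\<^sub>v(J\<^sub>k)\<close> are non-empty, compact, and of diameter at
  most \<open>c\<^sup>k diam X\<close>. Two different words are joined by an edge of the nerve iff their pieces meet.
  The nerve is connected iff no non-empty proper set of words is closed under passing to an
  adjacent word (\<open>connected_complex_iff_no_proper_edge_closed_set\<close>).

  If some set \<open>A\<close> of words is such a set, then the union of the pieces of words in \<open>A\<close> and the
  union of the remaining pieces are disjoint non-empty closed sets with union \<open>J\<close>, so \<open>J\<close> is
  disconnected. If, conversely, \<open>J\<close> is the disjoint union of non-empty closed sets \<open>A\<close> and \<open>B\<close>, then
  these have positive distance. For large \<open>k\<close> every piece lies in \<open>A\<close> or in \<open>B\<close>, and adjacent words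
  have their pieces on the same side, so the words with piece in \<open>A\<close> disconnect the nerve.

  Compactness of \<open>J\<close> comes from Tychonoff's theorem: the coding map is continuous on the product of
  the finite discrete spaces \<open>I m\<close>, because sequences with the same first \<open>n\<close> entries are coded
  by points at distance at most \<open>c\<^sup>n diam X\<close>.
\<close>

section \<open>Connected abstract complexes\<close>

lemma equiv_generated_equiv:
  assumes "E \<subseteq> V \<times> V"
  shows "equiv V (generated_equiv V E)"
proof -
  have "equiv V (V \<times> V)"
    by (auto simp: equiv_def refl_on_def sym_def trans_def)
  then have sub: "generated_equiv V E \<subseteq> V \<times> V"
    using assms unfolding generated_equiv_def by blast
  have "refl_on V (generated_equiv V E)"
    by (auto simp: generated_equiv_def equiv_def refl_on_def)
  moreover have "sym (generated_equiv V E)"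
    unfolding generated_equiv_def by (rule symI) (auto simp: equiv_def dest: symD)
  moreover have "trans (generated_equiv V E)"
    unfolding generated_equiv_def by (rule transI) (auto simp: equiv_def dest: transD)
  ultimately show ?thesis
    using sub by (auto simp: equiv_def)
qed

lemma subset_generated_equiv: "E \<subseteq> generated_equiv V E"
  unfolding generated_equiv_def by blast

lemma connected_complex_iff_no_proper_edge_closed_set:
  assumes E: "edge_rel K \<subseteq> vertices K \<times> vertices K" and ne: "vertices K \<noteq> {}"
  shows "connected_complex K \<longleftrightarrow>
    (\<forall>A\<subseteq>vertices K. A \<noteq> {} \<longrightarrow> (\<forall>(u, v)\<in>edge_rel K. u \<in> A \<longleftrightarrow> v \<in> A) \<longrightarrow> A = vertices K)"
    (is "?L \<longleftrightarrow> ?R")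
proof -
  let ?V = "vertices K"
  define R where "R = generated_equiv ?V (edge_rel K)"
  have R: "equiv ?V R" and ER: "edge_rel K \<subseteq> R"
    using equiv_generated_equiv[OF E] subset_generated_equiv unfolding R_def by auto
  show ?thesis
  proof
    assume L: ?L
    show ?R
    proof (intro allI impI)
      fix A assume A: "A \<subseteq> ?V" "A \<noteq> {}" "\<forall>(u, v)\<in>edge_rel K. u \<in> A \<longleftrightarrow> v \<in> A"
      let ?RA = "{(u, v). u \<in> ?V \<and> v \<in> ?V \<and> (u \<in> A \<longleftrightarrow> v \<in> A)}"
      have "equiv ?V ?RA"
        by (auto simp: equiv_def refl_on_def sym_def trans_def)
      moreover have "edge_rel K \<subseteq> ?RA"
        using A(3) E by auto
      ultimately have sub: "R \<subseteq> ?RA"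
        unfolding R_def generated_equiv_def by blast
      obtain a where a: "a \<in> A" using A(2) by auto
      have "v \<in> A" if v: "v \<in> ?V" for v
      proof -
        have "R `` {a} \<in> ?V // R" "R `` {v} \<in> ?V // R"
          using a v A(1) by (auto intro: quotientI)
        then have "R `` {a} = R `` {v}"
          using L unfolding connected_complex_def R_def by blast
        then have "(a, v) \<in> R"
          using R v a A(1) by (metis eq_equiv_class)
        then show ?thesis using sub a by auto
      qed
      then show "A = ?V" using A(1) by auto
    qed
  next
    assume H: ?R
    have cls: "R `` {a} = ?V" if a: "a \<in> ?V" for a
    proof -
      have "R `` {a} \<subseteq> ?V" using R by (auto simp: equiv_def)
      moreover have "R `` {a} \<noteq> {}"
        using R a by (metis equiv_class_self empty_iff)
      moreover have "\<forall>(u, v)\<in>edge_rel K. u \<in> R `` {a} \<longleftrightarrow> v \<in> R `` {a}"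
        using ER R by (auto simp: equiv_def dest: symD transD)
      ultimately show ?thesis using H by blast
    qed
    have "?V // R = {?V}"
      using cls ne by (auto simp: quotient_def)
    then show ?L
      unfolding connected_complex_def R_def[symmetric] by auto
  qed
qed

section \<open>Compositions along words\<close>

lemma word_map_0 [simp]: "word_map f 0 0 v = id"
  by (simp add: word_map_def)

lemma word_map_Suc: "word_map f 0 (Suc n) v = word_map f 0 n v \<circ> f (Suc n) (v (Suc n))"
proof -
  have fold: "foldr (\<lambda>m g. f m (v m) \<circ> g) xs h = foldr (\<lambda>m g. f m (v m) \<circ> g) xs id \<circ> h" for xs h
    by (induction xs) (simp_all add: comp_assoc)
  have "[Suc 0..<Suc (Suc n)] = [Suc 0..<Suc n] @ [Suc n]" by simp
  then show ?thesis
    unfolding word_map_def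
    by (simp only: foldr_append foldr.simps comp_apply id_apply comp_id)
       (rule fold)
qed

lemma word_map_add:
  "word_map f 0 (k + n) v
     = word_map f 0 k v \<circ> word_map (\<lambda>m. f (k + m)) 0 n (\<lambda>m. v (k + m))"
  by (induction n) (simp_all add: word_map_Suc comp_assoc)

lemma word_map_cong:
  assumes "\<And>m. 1 \<le> m \<Longrightarrow> m \<le> n \<Longrightarrow> v m = w m"
  shows "word_map f 0 n v = word_map f 0 n w"
  using assms by (induction n) (simp_all add: word_map_Suc)

lemma nonautonomous_ifs_shift:
  "nonautonomous_ifs X I f \<Longrightarrow> nonautonomous_ifs X (\<lambda>m. I (k + m)) (\<lambda>m. f (k + m))"
  unfolding nonautonomous_ifs_def by (meson trans_le_add2)

lemma lipschitz_on_word_map: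
  assumes maps: "\<And>j i. 1 \<le> j \<Longrightarrow> i \<in> I j \<Longrightarrow> f j i \<in> X \<rightarrow> X"
    and lip: "\<And>j i. 1 \<le> j \<Longrightarrow> i \<in> I j \<Longrightarrow> c-lipschitz_on X (f j i)"
    and v: "\<And>m. 1 \<le> m \<Longrightarrow> m \<le> n \<Longrightarrow> v m \<in> I m"
  shows "word_map f 0 n v \<in> X \<rightarrow> X \<and> (c ^ n)-lipschitz_on X (word_map f 0 n v)"
  using v
proof (induction n)
  case 0
  then show ?case by (auto simp: lipschitz_on_def)
next
  case (Suc n)
  let ?g = "f (Suc n) (v (Suc n))"
  have g: "?g \<in> X \<rightarrow> X" "c-lipschitz_on X ?g"
    using maps lip Suc.prems by auto
  have IH: "word_map f 0 n v \<in> X \<rightarrow> X" "(c ^ n)-lipschitz_on X (word_map f 0 n v)"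
    using Suc by auto
  have "(c ^ n * c)-lipschitz_on X (word_map f 0 n v \<circ> ?g)"
  proof (rule lipschitz_on_compose)
    show "(c ^ n)-lipschitz_on (?g ` X) (word_map f 0 n v)"
      using g(1) by (intro lipschitz_on_subset[OF IH(2)]) auto
  qed (rule g(2))
  then show ?case
    using g IH by (auto simp: word_map_Suc mult.commute)
qed

lemma
  assumes "nonautonomous_ifs X I f" and "\<And>m. 1 \<le> m \<Longrightarrow> m \<le> n \<Longrightarrow> v m \<in> I m"
  shows word_map_in_funcset: "word_map f 0 n v \<in> X \<rightarrow> X"
    and continuous_on_word_map: "continuous_on X (word_map f 0 n v)"
proof -
  obtain c where "\<And>j i. 1 \<le> j \<Longrightarrow> i \<in> I j \<Longrightarrow> f j i \<in> X \<rightarrow> X"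
    "\<And>j i. 1 \<le> j \<Longrightarrow> i \<in> I j \<Longrightarrow> c-lipschitz_on X (f j i)"
    using assms(1) unfolding nonautonomous_ifs_def by metis
  from lipschitz_on_word_map[where f = f and I = I and v = v, OF this assms(2)]
  show "word_map f 0 n v \<in> X \<rightarrow> X" "continuous_on X (word_map f 0 n v)"
    by (auto intro: lipschitz_on_continuous_on)
qed

text \<open>
  The contraction ratio enters only through this uniform statement: all images of \<open>X\<close> under words of
  some length \<open>n\<close> have diameter less than \<open>d\<close>.
\<close>

lemma small_word_map_images:
  assumes X: "compact X" and ifs: "nonautonomous_ifs X I f" and d: "d > 0"
  obtains n where "n > 0"
    "\<And>v x y. (\<And>m. 1 \<le> m \<Longrightarrow> m \<le> n \<Longrightarrow> v m \<in> I m) \<Longrightarrow> x \<in> X \<Longrightarrow> y \<in> X \<Longrightarrow>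
       dist (word_map f 0 n v x) (word_map f 0 n v y) < d"
proof -
  obtain c where c: "c < 1" "\<And>j i. 1 \<le> j \<Longrightarrow> i \<in> I j \<Longrightarrow> f j i \<in> X \<rightarrow> X"
    "\<And>j i. 1 \<le> j \<Longrightarrow> i \<in> I j \<Longrightarrow> c-lipschitz_on X (f j i)"
    using ifs unfolding nonautonomous_ifs_def by metis
  obtain i where "i \<in> I 1"
    using ifs unfolding nonautonomous_ifs_def by (metis ex_in_conv order_refl)
  then have c0: "0 \<le> c" using c(3)[of 1 i] by (auto simp: lipschitz_on_def)
  have "(\<lambda>n. c ^ n * diameter X) \<longlonglongrightarrow> 0 * diameter X"
    using c0 c(1) by (intro tendsto_mult tendsto_const LIMSEQ_power_zero) auto
  then have "eventually (\<lambda>n. c ^ n * diameter X < d) sequentially"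
    using d by (auto dest: order_tendstoD)
  then have "eventually (\<lambda>n. c ^ n * diameter X < d \<and> n > 0) sequentially"
    using eventually_gt_at_top[of "0::nat"] by (rule eventually_conj)
  then obtain n where n: "c ^ n * diameter X < d" "n > 0"
    by (auto dest: eventually_happens)
  have "dist (word_map f 0 n v x) (word_map f 0 n v y) < d"
    if v: "\<And>m. 1 \<le> m \<Longrightarrow> m \<le> n \<Longrightarrow> v m \<in> I m" and x: "x \<in> X" and y: "y \<in> X" for v x y
  proof -
    have "(c ^ n)-lipschitz_on X (word_map f 0 n v)"
      using lipschitz_on_word_map[where f = f and I = I and v = v, OF c(2,3) v] by blast
    then have "dist (word_map f 0 n v x) (word_map f 0 n v y) \<le> c ^ n * dist x y"
      using x y by (auto simp: lipschitz_on_def)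
    also have "\<dots> \<le> c ^ n * diameter X"
      using c0 x y X by (intro mult_left_mono diameter_bounded_bound)
                        (auto intro: compact_imp_bounded)
    finally show ?thesis using n(1) by simp
  qed
  with n(2) show ?thesis by (rule that)
qed

section \<open>The coding map\<close>

lemma decseq_word_map_images:
  assumes ifs: "nonautonomous_ifs X I f" and s: "\<sigma> \<in> Pi {1..} I"
  shows "decseq (\<lambda>n. word_map f 0 n \<sigma> ` X)"
proof (rule decseq_SucI)
  fix n
  have "f (Suc n) (\<sigma> (Suc n)) \<in> X \<rightarrow> X"
    using ifs s unfolding nonautonomous_ifs_def by (auto simp: Pi_iff)
  then show "word_map f 0 (Suc n) \<sigma> ` X \<subseteq> word_map f 0 n \<sigma> ` X"
    by (auto simp: word_map_Suc)
qed

lemma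
  assumes X: "compact X" and ne: "X \<noteq> {}" and ifs: "nonautonomous_ifs X I f"
    and s: "\<sigma> \<in> Pi {1..} I"
  shows coding_map_in_image: "coding_map X f \<sigma> \<in> word_map f 0 n \<sigma> ` X"
    and coding_map_eqI: "(\<And>n. y \<in> word_map f 0 n \<sigma> ` X) \<Longrightarrow> coding_map X f \<sigma> = y"
proof -
  let ?F = "\<lambda>n. word_map f 0 n \<sigma> ` X"
  have s': "\<sigma> m \<in> I m" if "1 \<le> m" for m using s that by auto
  have dec: "decseq ?F" by (rule decseq_word_map_images[OF ifs s])
  have "X \<inter> (\<Inter>n\<in>UNIV. ?F n) \<noteq> {}"
  proof (rule compact_imp_fip_image[OF X])
    show "closed (?F n)" for n
      using continuous_on_word_map[OF ifs, of n \<sigma>] s' X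
      by (auto intro: compact_imp_closed compact_continuous_image)
    fix S :: "nat set" assume "finite S"
    then obtain N where "S \<subseteq> {..N}" using finite_nat_iff_bounded_le by auto
    then have "?F N \<subseteq> (\<Inter>n\<in>S. ?F n)" using decseqD[OF dec] by blast
    moreover have "?F N \<subseteq> ?F 0" using dec by (rule decseqD) simp
    ultimately have "?F N \<subseteq> X \<inter> (\<Inter>n\<in>S. ?F n)" by simp
    moreover have "?F N \<noteq> {}" using ne by simp
    ultimately show "X \<inter> (\<Inter>n\<in>S. ?F n) \<noteq> {}" by (metis subset_empty)
  qed
  then obtain x where x: "\<And>n. x \<in> ?F n" by blast
  have uniq: "y = z" if y: "\<And>n. y \<in> ?F n" and z: "\<And>n. z \<in> ?F n" for y z
  proof (rule ccontr)
    assume "y \<noteq> z"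
    then have "dist y z > 0" by simp
    then obtain n where n: "\<And>v x x'. (\<And>m. 1 \<le> m \<Longrightarrow> m \<le> n \<Longrightarrow> v m \<in> I m) \<Longrightarrow> x \<in> X \<Longrightarrow> x' \<in> X \<Longrightarrow>
       dist (word_map f 0 n v x) (word_map f 0 n v x') < dist y z"
      by (rule small_word_map_images[OF X ifs]) blast
    show False using n[of \<sigma>] y[of n] z[of n] s' by fastforce
  qed
  \<comment> \<open>The intersection in the definition starts at 1, but the image of length 0 is \<open>X\<close> itself.\<close>
  have Int: "(\<Inter>n\<in>{1..}. ?F n) = (\<Inter>n. ?F n)"
  proof -
    have "?F 1 \<subseteq> ?F 0" using dec by (rule decseqD) simp
    then have "z \<in> ?F n" if "\<forall>n\<ge>1. z \<in> ?F n" for z n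
      using that by (cases n) auto
    then show ?thesis by auto
  qed
  have sing: "(\<Inter>n\<in>{1..}. ?F n) = {x}"
    unfolding Int
  proof (intro equalityI subsetI)
    fix z assume "z \<in> (\<Inter>n. ?F n)"
    then have "z = x" by (intro uniq x) blast
    then show "z \<in> {x}" by simp
  qed (use x in simp)
  have cx: "coding_map X f \<sigma> = x"
    unfolding coding_map_def sing by auto
  show "coding_map X f \<sigma> \<in> ?F n" using cx x by simp
  show "coding_map X f \<sigma> = y" if "\<And>n. y \<in> ?F n"
    unfolding cx by (rule uniq[OF x that])
qed

lemma coding_map_cong:
  assumes "\<And>m. 1 \<le> m \<Longrightarrow> \<sigma> m = \<tau> m"
  shows "coding_map X f \<sigma> = coding_map X f \<tau>"
proof -
  have "word_map f 0 n \<sigma> = word_map f 0 n \<tau>" for n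
    using assms by (intro word_map_cong)
  then show ?thesis by (simp add: coding_map_def)
qed

text \<open>
  The limit set is indexed by extensional sequences, but values outside \<open>{1..}\<close> do not affect the
  code. Working with \<open>Pi\<close> allows shifted and concatenated sequences without restricting them.
\<close>

lemma coding_map_in_limit_set:
  assumes "\<sigma> \<in> Pi {1..} I"
  shows "coding_map X f \<sigma> \<in> limit_set X I f"
proof -
  have "coding_map X f \<sigma> = coding_map X f (restrict \<sigma> {1..})"
    by (rule coding_map_cong) simp
  then show ?thesis
    using assms unfolding limit_set_def by (auto intro!: imageI simp: PiE_def)
qed

text \<open>The self-similarity relation: deleting the first \<open>k\<close> entries shifts the system by \<open>k\<close> steps.\<close>

lemma coding_map_shift:
  assumes X: "compact X" and ne: "X \<noteq> {}" and ifs: "nonautonomous_ifs X I f"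
    and s: "\<sigma> \<in> Pi {1..} I"
  shows "coding_map X f \<sigma>
    = word_map f 0 k \<sigma> (coding_map X (\<lambda>m. f (k + m)) (\<lambda>m. \<sigma> (k + m)))"
proof (rule coding_map_eqI[OF X ne ifs s])
  fix n
  let ?p = "coding_map X (\<lambda>m. f (k + m)) (\<lambda>m. \<sigma> (k + m))"
  have "(\<lambda>m. \<sigma> (k + m)) \<in> Pi {1..} (\<lambda>m. I (k + m))"
    using s by auto
  then have "?p \<in> word_map (\<lambda>m. f (k + m)) 0 n (\<lambda>m. \<sigma> (k + m)) ` X"
    by (rule coding_map_in_image[OF X ne nonautonomous_ifs_shift[OF ifs]])
  then have "word_map f 0 k \<sigma> ?p \<in> word_map f 0 (k + n) \<sigma> ` X"
    by (auto simp: word_map_add)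
  also have "\<dots> \<subseteq> word_map f 0 n \<sigma> ` X"
    using decseq_word_map_images[OF ifs s] by (rule decseqD) simp
  finally show "word_map f 0 k \<sigma> ?p \<in> word_map f 0 n \<sigma> ` X" .
qed

section \<open>The limit set\<close>

lemma limit_set_subset:
  assumes "compact X" "X \<noteq> {}" "nonautonomous_ifs X I f"
  shows "limit_set X I f \<subseteq> X"
proof -
  have "coding_map X f \<sigma> \<in> X" if "\<sigma> \<in> PiE {1..} I" for \<sigma>
    using coding_map_in_image[OF assms, of \<sigma> 0] that by (auto simp: PiE_def)
  then show ?thesis by (auto simp: limit_set_def)
qed

lemma limit_set_nonempty:
  assumes "nonautonomous_ifs X I f"
  shows "limit_set X I f \<noteq> {}"
proof -
  have "PiE {1..} I \<noteq> {}"
    using assms by (auto simp: PiE_eq_empty_iff nonautonomous_ifs_def)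
  then show ?thesis by (simp add: limit_set_def)
qed

lemma compact_limit_set:
  assumes X: "compact X" and ne: "X \<noteq> {}" and ifs: "nonautonomous_ifs X I f"
  shows "compact (limit_set X I f)"
proof -
  let ?T = "product_topology (\<lambda>m. discrete_topology (I m)) {1..}"
  have top: "topspace ?T = PiE {1..} I" by simp
  have "compact_space (discrete_topology (I m))" if "m \<in> {1..}" for m
    using ifs that by (simp add: nonautonomous_ifs_def compact_space_discrete_topology)
  then have cpt: "compact_space ?T"
    by (simp add: compact_space_product_topology)
  have "continuous_map ?T euclidean (coding_map X f)"
    unfolding continuous_map_def
  proof (intro conjI allI impI)
    show "coding_map X f \<in> topspace ?T \<rightarrow> topspace euclidean" by simp
    fix U :: "'a set" assume "openin euclidean U"
    then have U: "open U" by simp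
    show "openin ?T {\<sigma> \<in> topspace ?T. coding_map X f \<sigma> \<in> U}" (is "openin ?T ?W")
    proof (subst openin_subopen, intro ballI)
      fix \<sigma> assume "\<sigma> \<in> ?W"
      then have s: "\<sigma> \<in> PiE {1..} I" "coding_map X f \<sigma> \<in> U" unfolding top by auto
      obtain e where e: "e > 0" "ball (coding_map X f \<sigma>) e \<subseteq> U"
        using U s(2) by (auto simp: open_contains_ball)
      obtain n where n: "\<And>v x y. (\<And>m. 1 \<le> m \<Longrightarrow> m \<le> n \<Longrightarrow> v m \<in> I m) \<Longrightarrow> x \<in> X \<Longrightarrow> y \<in> X \<Longrightarrow>
         dist (word_map f 0 n v x) (word_map f 0 n v y) < e"
        by (rule small_word_map_images[OF X ifs e(1)]) blast
      \<comment> \<open>The cylinder of all sequences that agree with \<open>\<sigma>\<close> up to time \<open>n\<close>.\<close>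
      let ?C = "PiE {1..} (\<lambda>m. if m \<le> n then {\<sigma> m} else I m)"
      have "openin ?T ?C"
        unfolding openin_PiE_gen
      proof (intro disjI2 conjI ballI)
        have "{m \<in> {1..}. (if m \<le> n then {\<sigma> m} else I m) \<noteq> topspace (discrete_topology (I m))} \<subseteq> {..n}"
          by auto
        then show "finite {m \<in> {1..}. (if m \<le> n then {\<sigma> m} else I m) \<noteq> topspace (discrete_topology (I m))}"
          by (rule finite_subset) simp
      qed (use s(1) in auto)
      moreover have "\<sigma> \<in> ?C" using s(1) by (auto simp: PiE_iff)
      moreover have "?C \<subseteq> ?W"
      proof
        fix \<tau> assume t: "\<tau> \<in> ?C"
        have agree: "\<tau> m = \<sigma> m" if "1 \<le> m" "m \<le> n" for m
          using PiE_mem[OF t, of m] that by auto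
        have tI: "\<tau> m \<in> I m" if "1 \<le> m" for m
          using PiE_mem[OF t, of m] PiE_mem[OF s(1), of m] that by (auto split: if_splits)
        have tP: "\<tau> \<in> PiE {1..} I"
          using t tI by (auto simp: PiE_iff)
        have "word_map f 0 n \<tau> = word_map f 0 n \<sigma>"
          using agree by (rule word_map_cong)
        moreover have "coding_map X f \<tau> \<in> word_map f 0 n \<tau> ` X"
          using tP by (intro coding_map_in_image[OF X ne ifs]) auto
        moreover have "coding_map X f \<sigma> \<in> word_map f 0 n \<sigma> ` X"
          using s(1) by (intro coding_map_in_image[OF X ne ifs]) auto
        ultimately obtain x y where "x \<in> X" "y \<in> X"
          "coding_map X f \<sigma> = word_map f 0 n \<sigma> x" "coding_map X f \<tau> = word_map f 0 n \<sigma> y"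
          by auto
        then have "dist (coding_map X f \<sigma>) (coding_map X f \<tau>) < e"
          using n[of \<sigma> x y] s(1) by auto
        then show "\<tau> \<in> ?W" using e(2) tP by auto
      qed
      ultimately show "\<exists>C. openin ?T C \<and> \<sigma> \<in> C \<and> C \<subseteq> ?W" by blast
    qed
  qed
  then have "compactin euclidean (coding_map X f ` topspace ?T)"
    using cpt unfolding compact_space_def by (rule image_compactin[rotated])
  then show ?thesis unfolding top limit_set_def by simp
qed

lemma
  assumes "compact X" "X \<noteq> {}" "nonautonomous_ifs X I f"
  shows shifted_limit_set_subset: "shifted_limit_set X I f k \<subseteq> X"
    and shifted_limit_set_nonempty: "shifted_limit_set X I f k \<noteq> {}"
    and compact_shifted_limit_set: "compact (shifted_limit_set X I f k)"
proof -
  note shift = assms(1,2) nonautonomous_ifs_shift[OF assms(3)]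
  show "shifted_limit_set X I f k \<subseteq> X"
    unfolding shifted_limit_set_def by (rule limit_set_subset[OF shift])
  show "shifted_limit_set X I f k \<noteq> {}"
    unfolding shifted_limit_set_def by (rule limit_set_nonempty[OF shift(3)])
  show "compact (shifted_limit_set X I f k)"
    unfolding shifted_limit_set_def by (rule compact_limit_set[OF shift])
qed

lemma limit_set_decomposition:
  assumes X: "compact X" and ne: "X \<noteq> {}" and ifs: "nonautonomous_ifs X I f"
  shows "limit_set X I f = (\<Union>v\<in>words I 0 k. word_map f 0 k v ` shifted_limit_set X I f k)"
proof (intro equalityI subsetI)
  fix x assume "x \<in> limit_set X I f"
  then obtain \<sigma> where s: "\<sigma> \<in> PiE {1..} I" "x = coding_map X f \<sigma>"
    by (auto simp: limit_set_def)
  let ?v = "restrict \<sigma> {Suc 0..k}"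
  let ?p = "coding_map X (\<lambda>m. f (k + m)) (\<lambda>m. \<sigma> (k + m))"
  have v: "?v \<in> words I 0 k" using s(1) by (auto simp: words_def)
  have p: "?p \<in> shifted_limit_set X I f k"
    unfolding shifted_limit_set_def using s(1) by (intro coding_map_in_limit_set) auto
  have "x = word_map f 0 k \<sigma> ?p"
    unfolding s(2) using s(1) by (intro coding_map_shift[OF X ne ifs]) auto
  also have "word_map f 0 k \<sigma> = word_map f 0 k ?v"
    by (rule word_map_cong) simp
  finally show "x \<in> (\<Union>v\<in>words I 0 k. word_map f 0 k v ` shifted_limit_set X I f k)"
    using v p by blast
next
  fix x assume "x \<in> (\<Union>v\<in>words I 0 k. word_map f 0 k v ` shifted_limit_set X I f k)"
  then obtain v \<tau> where v: "v \<in> words I 0 k" and t: "\<tau> \<in> PiE {1..} (\<lambda>m. I (k + m))"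
    and x: "x = word_map f 0 k v (coding_map X (\<lambda>m. f (k + m)) \<tau>)"
    unfolding shifted_limit_set_def limit_set_def by blast
  \<comment> \<open>The concatenation of \<open>v\<close> and \<open>\<tau>\<close>.\<close>
  define \<sigma> where "\<sigma> m = (if m \<le> k then v m else \<tau> (m - k))" for m
  have "\<sigma> m \<in> I m" if "1 \<le> m" for m
  proof (cases "m \<le> k")
    case True
    then show ?thesis using v that by (auto simp: \<sigma>_def words_def)
  next
    case False
    then have "\<tau> (m - k) \<in> I (k + (m - k))" by (intro PiE_mem[OF t]) auto
    then show ?thesis using False by (simp add: \<sigma>_def)
  qed
  then have s: "\<sigma> \<in> Pi {1..} I" by auto
  have "coding_map X f \<sigma>
      = word_map f 0 k \<sigma> (coding_map X (\<lambda>m. f (k + m)) (\<lambda>m. \<sigma> (k + m)))"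
    by (rule coding_map_shift[OF X ne ifs s])
  also have "coding_map X (\<lambda>m. f (k + m)) (\<lambda>m. \<sigma> (k + m)) = coding_map X (\<lambda>m. f (k + m)) \<tau>"
    by (rule coding_map_cong) (simp add: \<sigma>_def)
  also have "word_map f 0 k \<sigma> = word_map f 0 k v"
    by (rule word_map_cong) (simp add: \<sigma>_def)
  finally have "x = coding_map X f \<sigma>" using x by simp
  then show "x \<in> limit_set X I f" using coding_map_in_limit_set[OF s] by simp
qed

section \<open>Connectedness of the nerves\<close>

lemma
  assumes "nonautonomous_ifs X I f"
  shows finite_words: "finite (words I 0 k)" and words_nonempty: "words I 0 k \<noteq> {}"
  using assms by (auto simp: words_def nonautonomous_ifs_def PiE_eq_empty_iff intro!: finite_PiE)

text \<open>
  Here \<open>u\<close> and \<open>v\<close> need not be distinct as in an edge of the nerve: the condition is trivial for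
  \<open>u = v\<close>.
\<close>

lemma connected_nerve_iff:
  assumes ifs: "nonautonomous_ifs X I f"
  defines "P \<equiv> \<lambda>k v. word_map f 0 k v ` shifted_limit_set X I f k"
  shows "connected_complex (nerve X I f 0 k) \<longleftrightarrow>
    (\<forall>A\<subseteq>words I 0 k. A \<noteq> {} \<longrightarrow>
      (\<forall>u\<in>words I 0 k. \<forall>v\<in>words I 0 k. P k u \<inter> P k v \<noteq> {} \<longrightarrow> (u \<in> A \<longleftrightarrow> v \<in> A)) \<longrightarrow>
      A = words I 0 k)"
proof -
  let ?K = "nerve X I f 0 k"
  have V: "vertices ?K = words I 0 k" by (simp add: nerve_def)
  have edge: "(u, v) \<in> edge_rel ?K \<longleftrightarrow>
      u \<noteq> v \<and> u \<in> words I 0 k \<and> v \<in> words I 0 k \<and> P k u \<inter> P k v \<noteq> {}" for u v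
    by (auto simp: edge_rel_def nerve_def P_def)
  have E: "edge_rel ?K \<subseteq> vertices ?K \<times> vertices ?K"
    using edge V by auto
  have "(\<forall>(u, v)\<in>edge_rel ?K. u \<in> A \<longleftrightarrow> v \<in> A) \<longleftrightarrow>
      (\<forall>u\<in>words I 0 k. \<forall>v\<in>words I 0 k. P k u \<inter> P k v \<noteq> {} \<longrightarrow> (u \<in> A \<longleftrightarrow> v \<in> A))" for A
  proof (rule iffI; intro ballI impI)
    fix u v
    assume H: "\<forall>(u, v)\<in>edge_rel ?K. u \<in> A \<longleftrightarrow> v \<in> A"
      and uv: "u \<in> words I 0 k" "v \<in> words I 0 k" "P k u \<inter> P k v \<noteq> {}"
    show "u \<in> A \<longleftrightarrow> v \<in> A"
    proof (cases "u = v")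
      case False
      then have "(u, v) \<in> edge_rel ?K" using uv by (simp only: edge) simp
      then show ?thesis using H by blast
    qed simp
  next
    fix p
    assume H: "\<forall>u\<in>words I 0 k. \<forall>v\<in>words I 0 k. P k u \<inter> P k v \<noteq> {} \<longrightarrow> (u \<in> A \<longleftrightarrow> v \<in> A)"
      and p: "p \<in> edge_rel ?K"
    obtain u v where uv: "p = (u, v)" by (cases p)
    then have "u \<in> words I 0 k" "v \<in> words I 0 k" "P k u \<inter> P k v \<noteq> {}"
      using p edge[of u v] by auto
    then have "u \<in> A \<longleftrightarrow> v \<in> A" using H by blast
    then show "case p of (u, v) \<Rightarrow> u \<in> A \<longleftrightarrow> v \<in> A" using uv by simp
  qed
  then show ?thesis
    using connected_complex_iff_no_proper_edge_closed_set[OF E] words_nonempty[OF ifs, of k]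
    unfolding V by simp
qed

theorem theorem4:
  fixes X :: "'a::metric_space set"
    and I :: "nat \<Rightarrow> 'i set"
    and f :: "nat \<Rightarrow> 'i \<Rightarrow> 'a \<Rightarrow> 'a"
  assumes "compact X" and "X \<noteq> {}"
    and "nonautonomous_ifs X I f"
  shows "connected (limit_set X I f) \<longleftrightarrow> (\<forall>k>0. connected_complex (nerve X I f 0 k))"
proof -
  note X = assms(1) and ne = assms(2) and ifs = assms(3)
  let ?J = "limit_set X I f"
  define P where "P k v = word_map f 0 k v ` shifted_limit_set X I f k" for k v
  have J: "?J = (\<Union>v\<in>words I 0 k. P k v)" for k
    unfolding P_def by (rule limit_set_decomposition[OF X ne ifs])
  have Pne: "P k v \<noteq> {}" for k v
    unfolding P_def using shifted_limit_set_nonempty[OF X ne ifs] by auto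
  have letter: "v m \<in> I m" if "v \<in> words I 0 k" "1 \<le> m" "m \<le> k" for k v m
    using that by (auto simp: words_def)
  have Pclosed: "closed (P k v)" if v: "v \<in> words I 0 k" for k v
  proof -
    have "continuous_on X (word_map f 0 k v)"
      using letter[OF v] by (rule continuous_on_word_map[OF ifs])
    then have "continuous_on (shifted_limit_set X I f k) (word_map f 0 k v)"
      using shifted_limit_set_subset[OF X ne ifs] continuous_on_subset by blast
    then have "compact (P k v)"
      unfolding P_def using compact_shifted_limit_set[OF X ne ifs] by (rule compact_continuous_image)
    then show ?thesis by (rule compact_imp_closed)
  qed
  note nerve_iff = connected_nerve_iff[OF ifs, folded P_def]
  show ?thesis
  proof
    assume conn: "connected ?J"
    show "\<forall>k>0. connected_complex (nerve X I f 0 k)"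
    proof (intro allI impI, unfold nerve_iff, intro allI impI)
      fix k :: nat and A
      let ?V = "words I 0 k"
      assume A: "A \<subseteq> ?V" "A \<noteq> {}"
        and sep: "\<forall>u\<in>?V. \<forall>v\<in>?V. P k u \<inter> P k v \<noteq> {} \<longrightarrow> (u \<in> A \<longleftrightarrow> v \<in> A)"
      show "A = ?V"
      proof (rule ccontr)
        assume "A \<noteq> ?V"
        then have ne': "?V - A \<noteq> {}" using A(1) by auto
        let ?B = "\<lambda>S. \<Union>v\<in>S. P k v"
        have fin: "finite S" if "S \<subseteq> ?V" for S
          using finite_words[OF ifs] that by (rule rev_finite_subset)
        have "closed (?B A)" "closed (?B (?V - A))"
          using A(1) Pclosed fin by (auto intro!: closed_UN)
        moreover have "?B A \<inter> ?J \<noteq> {}" "?B (?V - A) \<inter> ?J \<noteq> {}"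
          using A ne' Pne unfolding J[of k] by blast+
        moreover have "?J \<subseteq> ?B A \<union> ?B (?V - A)" unfolding J[of k] by blast
        moreover have "?B A \<inter> ?B (?V - A) \<inter> ?J = {}"
          using sep A(1) by blast
        ultimately show False
          using conn unfolding connected_closed by blast
      qed
    qed
  next
    assume nerves: "\<forall>k>0. connected_complex (nerve X I f 0 k)"
    show "connected ?J"
    proof (rule ccontr)
      assume "\<not> connected ?J"
      moreover have Jc: "compact ?J" by (rule compact_limit_set[OF X ne ifs])
      ultimately obtain A B where AB: "closed A" "closed B" "A \<noteq> {}" "B \<noteq> {}"
        "A \<union> B = ?J" "A \<inter> B = {}"
        using connected_closed_set[OF compact_imp_closed] by metis
      have "compact A" using Jc AB(1,5) by (metis compact_Int_closed inf_sup_absorb inf_commute)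
      then have "setdist A B > 0"
        using AB by (simp add: setdist_gt_0_compact_closed)
      then obtain d where d: "d > 0" "\<And>x y. x \<in> A \<Longrightarrow> y \<in> B \<Longrightarrow> d \<le> dist x y"
        using setdist_le_dist by metis
      obtain k where k: "k > 0"
        "\<And>v x y. (\<And>m. 1 \<le> m \<Longrightarrow> m \<le> k \<Longrightarrow> v m \<in> I m) \<Longrightarrow> x \<in> X \<Longrightarrow> y \<in> X \<Longrightarrow>
           dist (word_map f 0 k v x) (word_map f 0 k v y) < d"
        using small_word_map_images[OF X ifs d(1)] by metis
      let ?V = "words I 0 k"
      have small: "dist x y < d" if v: "v \<in> ?V" and "x \<in> P k v" "y \<in> P k v" for v x y
        using that k(2)[OF letter[OF v]] shifted_limit_set_subset[OF X ne ifs, of k]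
        unfolding P_def by blast
      have side: "P k v \<subseteq> A" if v: "v \<in> ?V" and x: "x \<in> P k v" "x \<in> A" for v x
      proof
        fix y assume y: "y \<in> P k v"
        then have "y \<in> A \<union> B" using v AB(5) J[of k] by blast
        then show "y \<in> A" using d(2)[of x y] small[OF v x(1) y] x(2) by auto
      qed
      let ?S = "{v \<in> ?V. P k v \<subseteq> A}"
      obtain a where a: "a \<in> A" using AB(3) by auto
      then obtain v where "v \<in> ?V" "a \<in> P k v" using AB(5) unfolding J[of k] by blast
      then have "?S \<noteq> {}" using side[of v a] a by auto
      moreover have "?S \<subseteq> ?V" by auto
      moreover have "\<forall>u\<in>?V. \<forall>v\<in>?V. P k u \<inter> P k v \<noteq> {} \<longrightarrow> (u \<in> ?S \<longleftrightarrow> v \<in> ?S)"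
      proof (intro ballI impI)
        fix u v assume uv: "u \<in> ?V" "v \<in> ?V" "P k u \<inter> P k v \<noteq> {}"
        then obtain x where x: "x \<in> P k u" "x \<in> P k v" by auto
        show "u \<in> ?S \<longleftrightarrow> v \<in> ?S"
          using side[OF uv(1) x(1)] side[OF uv(2) x(2)] x uv(1,2) by auto
      qed
      ultimately have "?S = ?V"
        using nerves[rule_format, OF k(1)] unfolding nerve_iff[of k] by meson
      then have "P k v \<subseteq> A" if "v \<in> ?V" for v using that by auto
      then have "?J \<subseteq> A" unfolding J[of k] by (rule UN_least)
      then show False using AB(4,5,6) by blast
    qed
  qed
qed

end
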